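(* Let $F:\mathbb{R}^d\to\mathbb{R}^d$ be $L$-Lipschitz and $\mu$-quasi strongly monotone with $\mu>0$, i.e. $\langle F(x),x-x^*\rangle\ge\mu\|x-x^*\|^2$ for all $x\in\mathbb{R}^d$, where $x^*$ is the unique point with $F(x^* )=0$. Assume the stochastic estimators satisfy $\mathbb{E}_\xi[F_\xi(x)]=F(x)$ and $\mathbb{E}_\xi[\|F_\xi(x)-F(x)\|^2]\le\delta\|x-x^*\|^2+\sigma^2$ for all $x\in\mathbb{R}^d$, with $\delta,\sigma\ge0$. Let $$\gamma=\min\left\{\frac{\mu b}{18\delta},\ \frac{1}{4\mu+\sqrt{6(L^2+2\delta/b)}}\right\}.$$ Let $K\ge0$, $k_0=\lceil K/2\rceil$, and define $\{\beta_k\}_{k\ge0}$ by: $\beta_k=1$ if $K\le\frac{32}{\gamma\mu}$; $\beta_k=1$ if $K>\frac{32}{\gamma\mu}$ and $k<k_0$; $\beta_k=\dfrac{64}{64+\gamma\mu(k-k_0)}$ if $K>\frac{32}{\gamma\mu}$ and $k\ge k_0$. Then the iterates of I-SEG with batchsize $b$ and stepsizes $\gamma_{1,k}=\beta_k\gamma$, $\gamma_{2,k}=\frac14\gamma_{1,k}$ satisfy $$\mathbb{E}\left[\|x^K-x^*\|^2\right]\le\frac{1024\|x^0-x^*\|^2}{\gamma\mu}\exp\left(-\frac{\gamma\mu K}{64}\right)+\frac{69120\,\sigma^2}{\mu^2bK}.$$ Consequently, with $\kappa=\max\left\{\frac{\delta}{\mu^2b},\frac{L+\sqrt{\delta/b}}{\mu}\right\}$,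 there are absolute constants $c_1,c_2,c_3>0$ such that $$\mathbb{E}\left[\|x^K-x^*\|^2\right]\le c_1\kappa\|x^0-x^*\|^2\exp\left(-\frac{c_2K}{\kappa}\right)+\frac{c_3\sigma^2}{\mu^2bK}.$$
   Context: $\|\cdot\|$ is the Euclidean norm. Independent-samples stochastic extragradient (I-SEG) with batchsize $b\ge1$ and stepsizes $\gamma_{1,k},\gamma_{2,k}$, started at a deterministic $x^0\in\mathbb{R}^d$, is $$x^{k+1}=x^k-\gamma_{2,k}F_{\xi_2^k}\left(x^k-\gamma_{1,k}F_{\xi_1^k}(x^k)\right),\quad k\ge0,$$ with mini-batched estimators $$F_{\xi_1^k}(x^k)=\frac1b\sum_{i=1}^bF_{\xi_1^k(i)}(x^k),\qquad F_{\xi_2^k}\left(x^k-\gamma_{1,k}F_{\xi_1^k}(x^k)\right)=\frac1b\sum_{i=1}^bF_{\xi_2^k(i)}\left(x^k-\gamma_{1,k}F_{\xi_1^k}(x^k)\right),$$ where all samples $\xi_1^k(1),\dots,\xi_1^k(b),\xi_2^k(1),\dots,\xi_2^k(b)$, $k\ge0$, are i.i.d. copies of $\xi$. When $\delta=0$ the term $\mu b/(18\delta)$ is read as $+\infty$. *)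

theory Defs
  imports "HOL-Probability.Probability"
begin

definition quasi_strongly_monotone ::
    "real \<Rightarrow> ('v::real_inner \<Rightarrow> 'v) \<Rightarrow> 'v \<Rightarrow> bool" where
  "quasi_strongly_monotone \<mu> F xs \<longleftrightarrow>
     (\<forall>x. F x \<bullet> (x - xs) \<ge> \<mu> * (norm (x - xs))\<^sup>2)"

text \<open>
  The estimators are given as a field \<open>Fs s x\<close>, the operator drawn for the sample value \<open>s\<close>,
  evaluated at \<open>x\<close>; \<open>D\<close> is the law of the sample, so that the expectation over the sample is the
  integral with respect to \<open>D\<close>. Joint measurability makes the iterates random vectors. The
  integrability conditions are needed because the Bochner integral of a non-integrable function
  is 0, which would make the bound on the variance vacuous.
\<close>

definition unbiased_estimator ::
    "'s measure \<Rightarrow> ('s \<Rightarrow> real^'n \<Rightarrow> real^'n) \<Rightarrow> (real^'n \<Rightarrow> real^'n) \<Rightarrow> bool" where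
  "unbiased_estimator D Fs F \<longleftrightarrow>
     (\<lambda>(s, x). Fs s x) \<in> borel_measurable (D \<Otimes>\<^sub>M borel) \<and>
     (\<forall>x. integrable D (\<lambda>s. Fs s x) \<and> (\<integral>s. Fs s x \<partial>D) = F x)"

definition bounded_variance ::
    "'s measure \<Rightarrow> ('s \<Rightarrow> real^'n \<Rightarrow> real^'n) \<Rightarrow> (real^'n \<Rightarrow> real^'n) \<Rightarrow> real^'n \<Rightarrow> real \<Rightarrow> real \<Rightarrow> bool"
    where
  "bounded_variance D Fs F xs \<delta> \<sigma> \<longleftrightarrow>
     (\<forall>x. integrable D (\<lambda>s. (norm (Fs s x - F x))\<^sup>2) \<and>
          (\<integral>s. (norm (Fs s x - F x))\<^sup>2 \<partial>D) \<le> \<delta> * (norm (x - xs))\<^sup>2 + \<sigma>\<^sup>2)"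

definition minibatch ::
    "('s \<Rightarrow> 'v \<Rightarrow> 'v) \<Rightarrow> nat \<Rightarrow> (nat \<Rightarrow> 's) \<Rightarrow> 'v \<Rightarrow> 'v::real_vector" where
  "minibatch Fs b s x = (1 / real b) *\<^sub>R (\<Sum>i=1..b. Fs (s i) x)"

text \<open>
  In \<open>iseg\<close>, the sequences \<open>s1 k i\<close> and \<open>s2 k i\<close> are realizations of the samples used in
  iteration \<open>k\<close> for the extrapolation step and the update step, respectively.
\<close>

primrec iseg ::
    "('s \<Rightarrow> 'v \<Rightarrow> 'v) \<Rightarrow> nat \<Rightarrow> (nat \<Rightarrow> real) \<Rightarrow> (nat \<Rightarrow> real) \<Rightarrow> 'v \<Rightarrow>
     (nat \<Rightarrow> nat \<Rightarrow> 's) \<Rightarrow> (nat \<Rightarrow> nat \<Rightarrow> 's) \<Rightarrow> nat \<Rightarrow> 'v::real_vector" where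
  "iseg Fs b \<gamma>1 \<gamma>2 x0 s1 s2 0 = x0"
| "iseg Fs b \<gamma>1 \<gamma>2 x0 s1 s2 (Suc k) =
     (let x = iseg Fs b \<gamma>1 \<gamma>2 x0 s1 s2 k
      in x - \<gamma>2 k *\<^sub>R minibatch Fs b (s2 k) (x - \<gamma>1 k *\<^sub>R minibatch Fs b (s1 k) x))"

text \<open>
  For \<open>\<delta> = 0\<close> the first term of the minimum is read as infinity; in HOL it would be 0.
\<close>

definition iseg_gamma :: "real \<Rightarrow> real \<Rightarrow> real \<Rightarrow> nat \<Rightarrow> real" where
  "iseg_gamma L \<mu> \<delta> b =
     (let t = 1 / (4 * \<mu> + sqrt (6 * (L\<^sup>2 + 2 * \<delta> / real b)))
      in if \<delta> = 0 then t else min (\<mu> * real b / (18 * \<delta>)) t)"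

definition iseg_beta :: "real \<Rightarrow> real \<Rightarrow> nat \<Rightarrow> nat \<Rightarrow> real" where
  "iseg_beta \<gamma> \<mu> K k =
     (let k0 = nat \<lceil>real K / 2\<rceil>
      in if real K \<le> 32 / (\<gamma> * \<mu>) \<or> k < k0 then 1
         else 64 / (64 + \<gamma> * \<mu> * (real k - real k0)))"

definition iseg_kappa :: "real \<Rightarrow> real \<Rightarrow> real \<Rightarrow> nat \<Rightarrow> real" where
  "iseg_kappa L \<mu> \<delta> b =
     max (\<delta> / (\<mu>\<^sup>2 * real b)) ((L + sqrt (\<delta> / real b)) / \<mu>)"

text \<open>
  Absolute constants for the bound in terms of the condition number. An existential quantifier
  inside a theorem stands below the implicit quantification over its type variables, so it would
  let the constants depend on the dimension and on the sample types; fixed real numbers cannot.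
  The values come from \<open>\<gamma> \<mu> \<ge> 1 / (18 \<kappa>)\<close>, which holds because \<open>\<kappa> \<ge> L / \<mu> \<ge> 1\<close>:
  \<open>18432 = 18 * 1024\<close> and \<open>1152 = 18 * 64\<close>.
\<close>

definition iseg_c1 :: real where "iseg_c1 = 18432"
definition iseg_c2 :: real where "iseg_c2 = 1 / 1152"
definition iseg_c3 :: real where "iseg_c3 = 69120"

end

theory Submission imports Defs begin

text \<open>
  Write \<open>a\<close> for the extrapolation stepsize of an iteration, so that the update stepsize is
  \<open>a / 4\<close>, and \<open>e = norm (x - xs)\<close> for the distance of the current iterate to the solution.

  \<^emph>\<open>One iteration contracts the mean square error up to noise.\<close> At distance \<open>r\<close> from the
  solution, a minibatch of independent unbiased samples deviates from the operator with variance
  at most \<open>(\<delta> * r\<^sup>2 + \<sigma>\<^sup>2) / b\<close> (\<open>minibatch_second_moment\<close>). The update samples are independent of the iterate and of the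
  extrapolation point \<open>y\<close>, so averaging over them replaces the stochastic update direction by
  \<open>F y\<close>, at the cost of one variance term. What remains is a deterministic inequality, valid for
  every extrapolation direction \<open>g\<close> (\<open>extragradient_step_pointwise\<close>): quasi strong monotonicity
  at \<open>y\<close> gives the decrease, and \<open>F y \<bullet> g\<close> is positive up to the deviation
  \<open>norm (F y - g)\<close>, which the Lipschitz bound and the variance of \<open>g\<close> control. The direction
  \<open>g\<close> enters only through \<open>norm (g - F x)\<close>, so averaging over the extrapolation samples needs
  just their variance. The small update stepsize absorbs \<open>norm (F y)\<close>, the bounds on \<open>\<gamma>\<close> absorb the
  terms in \<open>norm g\<close> and \<open>\<delta>\<close>, and the outcome is
  \<open>E[e'\<^sup>2] \<le> (1 - a * \<mu> / 8) * E[e\<^sup>2] + 9 / 16 * a\<^sup>2 * \<sigma>\<^sup>2 / b\<close>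
  (\<open>iseg_mean_square_step\<close>).

  \<^emph>\<open>The schedule turns this recursion into the rate.\<close> The stepsizes are tuned for the smaller
  contraction \<open>\<mu> / 32\<close>. While the stepsize is constant, the initial error decays exponentially
  and the noise stays below a floor proportional to \<open>\<gamma>\<close>. If \<open>K\<close> is small, this floor is
  already of order \<open>1 / K\<close>; otherwise the first half of the run makes the exponential term
  small and the decreasing stepsizes of the second half bring the floor down to order
  \<open>1 / K\<close> (\<open>stepsize_schedule_recursion\<close>).

  \<^emph>\<open>The condition number.\<close> Since \<open>\<mu> \<le> L\<close>, one has \<open>\<kappa> \<ge> 1\<close> and \<open>\<gamma> * \<mu> \<ge> 1 / (18 * \<kappa>)\<close>, which turns
  the first bound into the second one.
\<close>

section \<open>The deterministic extragradient inequality\<close>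

text \<open>
  Expanding the square leaves the product \<open>F y \<bullet> (x - xs)\<close>, which splits into
  \<open>F y \<bullet> (y - xs)\<close>, bounded below by monotonicity, and \<open>a * (F y \<bullet> g)\<close>, rewritten by
  polarization. The summand \<open>d * (norm (y - xs))\<^sup>2 + s\<close> stands for the variance of the update
  estimator at \<open>y\<close>; keeping it on the left lets its first part be absorbed by the
  decrease at \<open>y\<close>, before that decrease is translated back to \<open>x\<close>.
\<close>

lemma extragradient_step_pointwise:
  fixes F :: "'v::real_inner \<Rightarrow> 'v"
    and xs x g :: 'v
  assumes lip: "L-lipschitz_on UNIV F" and qsm: "quasi_strongly_monotone \<mu> F xs"
    and mu: "0 \<le> \<mu>" and a: "0 \<le> a" "a * \<mu> \<le> 1 / 4" "6 * L\<^sup>2 * a\<^sup>2 \<le> 1" "a * d \<le> \<mu> / 18"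
  defines "y \<equiv> x - a *\<^sub>R g"
  shows "(norm (x - xs - (a / 4) *\<^sub>R F y))\<^sup>2 + (a / 4)\<^sup>2 * (d * (norm (y - xs))\<^sup>2 + s)
     \<le> (1 - a * \<mu> / 6) * (norm (x - xs))\<^sup>2 + a\<^sup>2 / 2 * (norm (g - F x))\<^sup>2 + a\<^sup>2 / 16 * s"
proof -
  define e z f h where "e = x - xs" and "z = y - xs" and "f = F y" and "h = F x"
  have e: "e = z + a *\<^sub>R g" by (simp add: e_def z_def y_def)
  have expand: "(norm (e - (a / 4) *\<^sub>R f))\<^sup>2
      = (norm e)\<^sup>2 - a / 2 * (f \<bullet> z) - a\<^sup>2 / 2 * (f \<bullet> g) + a\<^sup>2 / 16 * (norm f)\<^sup>2"
  proof -
    have "(norm (e - (a / 4) *\<^sub>R f))\<^sup>2 = (norm e)\<^sup>2 - a / 2 * (f \<bullet> e) + a\<^sup>2 / 16 * (norm f)\<^sup>2"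
      unfolding power2_norm_eq_inner
      by (simp add: inner_diff_left inner_diff_right inner_commute power2_eq_square field_simps)
    moreover have "f \<bullet> e = f \<bullet> z + a * (f \<bullet> g)"
      by (simp add: e inner_add_right)
    ultimately show ?thesis by (simp add: algebra_simps power2_eq_square)
  qed
  have young: "(norm (u + v))\<^sup>2 \<le> 2 * (norm u)\<^sup>2 + 2 * (norm v)\<^sup>2" for u v :: 'v
  proof -
    have "0 \<le> (norm (u - v))\<^sup>2" by simp
    then show ?thesis
      by (simp add: power2_norm_eq_inner inner_diff_left inner_diff_right inner_add_left
          inner_add_right inner_commute)
  qed
  have mono: "a / 2 * (\<mu> * (norm z)\<^sup>2) \<le> a / 2 * (f \<bullet> z)"
    using qsm a(1) by (intro mult_left_mono) (auto simp: quasi_strongly_monotone_def f_def z_def)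
  \<comment> \<open>Polarization makes the cross term positive up to the deviation of \<open>g\<close> from \<open>F y\<close>; the stepsize
    bound \<open>6 * L\<^sup>2 * a\<^sup>2 \<le> 1\<close> leaves two thirds of \<open>(norm g)\<^sup>2\<close>.\<close>
  have lip_f: "(norm (f - h))\<^sup>2 \<le> L\<^sup>2 * a\<^sup>2 * (norm g)\<^sup>2"
  proof -
    have "norm (f - h) \<le> L * norm (a *\<^sub>R g)"
      using lipschitz_onD[OF lip, of y x] by (simp add: dist_norm f_def h_def y_def)
    then have "(norm (f - h))\<^sup>2 \<le> (L * norm (a *\<^sub>R g))\<^sup>2"
      by (rule power_mono) simp
    then show ?thesis by (simp add: power_mult_distrib)
  qed
  have "2 * (f \<bullet> g) = (norm f)\<^sup>2 + (norm g)\<^sup>2 - (norm (f - g))\<^sup>2"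
    by (simp add: power2_norm_eq_inner inner_diff_left inner_diff_right inner_commute)
  moreover have "(norm (f - g))\<^sup>2 \<le> 2 * (norm (f - h))\<^sup>2 + 2 * (norm (g - h))\<^sup>2"
    using young[of "f - h" "h - g"] by (simp add: norm_minus_commute)
  moreover have "2 * (L\<^sup>2 * a\<^sup>2 * (norm g)\<^sup>2) \<le> 1 / 3 * (norm g)\<^sup>2"
    using mult_right_mono[OF a(3), of "(norm g)\<^sup>2"] by simp
  ultimately have "(norm f)\<^sup>2 + 2 / 3 * (norm g)\<^sup>2 - 2 * (norm (g - h))\<^sup>2 \<le> 2 * (f \<bullet> g)"
    using lip_f by linarith
  then have cross: "a\<^sup>2 / 4 * ((norm f)\<^sup>2 + 2 / 3 * (norm g)\<^sup>2 - 2 * (norm (g - h))\<^sup>2)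
      \<le> a\<^sup>2 / 4 * (2 * (f \<bullet> g))"
    by (intro mult_left_mono) auto
  have noise: "a / 16 * ((a * d) * (norm z)\<^sup>2) \<le> a / 16 * (\<mu> / 18 * (norm z)\<^sup>2)"
    using a by (intro mult_left_mono mult_right_mono) auto
  \<comment> \<open>The decrease is measured at \<open>y\<close>; passing to \<open>x\<close> costs a multiple of \<open>(norm g)\<^sup>2\<close>, which the
    surplus from the cross term pays for.\<close>
  have fallback: "a * \<mu> * (norm e)\<^sup>2 \<le> 2 * (a * \<mu> * (norm z)\<^sup>2) + a\<^sup>2 / 2 * (norm g)\<^sup>2"
  proof -
    have "a * \<mu> * (norm e)\<^sup>2 \<le> a * \<mu> * (2 * (norm z)\<^sup>2 + 2 * (a\<^sup>2 * (norm g)\<^sup>2))"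
      using young[of z "a *\<^sub>R g"] mu a(1)
      by (intro mult_left_mono) (auto simp: e power_mult_distrib)
    moreover have "a * \<mu> * (a\<^sup>2 * (norm g)\<^sup>2) \<le> 1 / 4 * (a\<^sup>2 * (norm g)\<^sup>2)"
      using a(2) by (intro mult_right_mono) auto
    ultimately show ?thesis by (simp add: algebra_simps)
  qed
  have "0 \<le> a * \<mu> * (norm z)\<^sup>2" "0 \<le> a\<^sup>2 * (norm g)\<^sup>2" "0 \<le> a\<^sup>2 * (norm f)\<^sup>2"
    using a mu by auto
  moreover have "a * \<mu> * (norm z)\<^sup>2 \<le> a * (f \<bullet> z)"
    using mono by simp
  moreover have "a\<^sup>2 * (norm f)\<^sup>2 / 2 + a\<^sup>2 * (norm g)\<^sup>2 / 3 - a\<^sup>2 * (norm (g - h))\<^sup>2 \<le> a\<^sup>2 * (f \<bullet> g)"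
    using cross by (simp add: algebra_simps)
  moreover have "a\<^sup>2 * d * (norm z)\<^sup>2 \<le> a * \<mu> * (norm z)\<^sup>2 / 18"
    using noise by (simp add: power2_eq_square[of a] mult.assoc)
  moreover have "(a / 4)\<^sup>2 * (d * (norm z)\<^sup>2 + s) = a\<^sup>2 * d * (norm z)\<^sup>2 / 16 + a\<^sup>2 / 16 * s"
    by (simp add: power_divide distrib_left add_divide_distrib)
  moreover have "(1 - a * \<mu> / 6) * (norm e)\<^sup>2 = (norm e)\<^sup>2 - a * \<mu> * (norm e)\<^sup>2 / 6"
    by (simp add: left_diff_distrib)
  ultimately show ?thesis
    unfolding e_def[symmetric] z_def[symmetric] f_def[symmetric] h_def[symmetric] expand
    using fallback by linarith
qed

section \<open>The stepsize schedule\<close>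

lemma iseg_beta_bounds:
  assumes "0 < \<gamma> * \<mu>"
  shows "0 \<le> iseg_beta \<gamma> \<mu> K k" "iseg_beta \<gamma> \<mu> K k \<le> 1"
proof -
  define k0 where "k0 = nat \<lceil>real K / 2\<rceil>"
  have "0 \<le> \<gamma> * \<mu> * (real k - real k0)" if "\<not> k < k0"
    using that assms by (intro mult_nonneg_nonneg[of "\<gamma> * \<mu>"]) auto
  then have "0 \<le> iseg_beta \<gamma> \<mu> K k \<and> iseg_beta \<gamma> \<mu> K k \<le> 1"
    unfolding iseg_beta_def k0_def[symmetric] Let_def by (auto simp: field_simps)
  then show "0 \<le> iseg_beta \<gamma> \<mu> K k" "iseg_beta \<gamma> \<mu> K k \<le> 1" by auto
qed

text \<open>
  With \<open>q = \<gamma> * \<mu>\<close> and constant stepsize the noise has the fixed point \<open>32 * c * \<gamma> / \<mu>\<close>. In the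
  decreasing stage, with \<open>t = 64 + q * j\<close>, the stepsize is \<open>64 * \<gamma> / t\<close>, and the noise bound
  \<open>C / t\<close> reproduces itself because \<open>(1 - 2 * q / t) * C / t + C * q / t\<^sup>2 = C * (t - q) / t\<^sup>2\<close>
  is at most \<open>C / (t + q)\<close>. The value \<open>C = 4096 * c * \<gamma> / \<mu>\<close> is forced by the size of the
  injected noise, and at \<open>t = 64\<close> the bound \<open>C / t\<close> is at least the floor of the first stage.
\<close>

lemma stepsize_schedule_recursion:
  fixes r :: "nat \<Rightarrow> real"
  assumes pos: "0 < \<gamma>" "0 < \<mu>" "0 \<le> c" "1 \<le> K" and small: "\<gamma> * \<mu> \<le> 32"
    and r0: "0 \<le> r 0"
    and rec: "\<And>k. r (Suc k) \<le> (1 - iseg_beta \<gamma> \<mu> K k * \<gamma> * \<mu> / 32) * r k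
                       + c * (iseg_beta \<gamma> \<mu> K k * \<gamma>)\<^sup>2"
  shows "r K \<le> exp (- (\<gamma> * \<mu> * real K / 64)) * r 0 + 8192 * c / (\<mu>\<^sup>2 * real K)"
proof -
  define q where "q = \<gamma> * \<mu>"
  define k0 where "k0 = nat \<lceil>real K / 2\<rceil>"
  have q: "0 < q" "q \<le> 32" using pos small by (auto simp: q_def)
  have k0: "real K / 2 \<le> real k0" "real k0 \<le> (real K + 1) / 2" "k0 \<le> K"
  proof -
    show lower: "real K / 2 \<le> real k0" unfolding k0_def by linarith
    have "real k0 < real K / 2 + 1" unfolding k0_def by linarith
    then have "2 * k0 < K + 2" by linarith
    then have "real (2 * k0) \<le> real (K + 1)" by (subst of_nat_le_iff) linarith
    then show "real k0 \<le> (real K + 1) / 2" by simp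
    show "k0 \<le> K" using \<open>2 * k0 < K + 2\<close> pos(4) by linarith
  qed
  have constant_stage: "r k \<le> exp (- (q * real k / 32)) * r 0 + 32 * c * \<gamma> / \<mu>"
    if "\<And>j. j < k \<Longrightarrow> iseg_beta \<gamma> \<mu> K j = 1" for k
    using that
  proof (induction k)
    case 0
    then show ?case using pos by simp
  next
    case (Suc k)
    have IH: "r k \<le> exp (- (q * real k / 32)) * r 0 + 32 * c * \<gamma> / \<mu>"
      using Suc by simp
    have "r (Suc k) \<le> (1 - q / 32) * r k + c * \<gamma>\<^sup>2"
      using rec[of k] Suc.prems[of k] by (simp add: q_def)
    also have "\<dots> \<le> (1 - q / 32) * (exp (- (q * real k / 32)) * r 0 + 32 * c * \<gamma> / \<mu>) + c * \<gamma>\<^sup>2"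
      using q IH by (intro add_right_mono mult_left_mono) auto
    also have "\<dots> = (1 - q / 32) * (exp (- (q * real k / 32)) * r 0) + 32 * c * \<gamma> / \<mu>"
      using pos by (simp add: q_def field_simps power2_eq_square)
    also have "(1 - q / 32) * (exp (- (q * real k / 32)) * r 0)
        \<le> exp (- (q / 32)) * (exp (- (q * real k / 32)) * r 0)"
      using exp_ge_add_one_self[of "- (q / 32)"] r0 by (intro mult_right_mono) auto
    also have "\<dots> = exp (- (q * real (Suc k) / 32)) * r 0"
      by (simp add: exp_add[symmetric] algebra_simps add_divide_distrib)
    finally show ?case by simp
  qed
  show ?thesis
  proof (cases "real K \<le> 32 / q")
    case True
    have "iseg_beta \<gamma> \<mu> K j = 1" for j
      using True by (simp add: iseg_beta_def q_def)
    then have "r K \<le> exp (- (q * real K / 32)) * r 0 + 32 * c * \<gamma> / \<mu>"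
      using constant_stage by blast
    moreover have "exp (- (q * real K / 32)) * r 0 \<le> exp (- (q * real K / 64)) * r 0"
      using q r0 by (intro mult_right_mono) auto
    moreover have "32 * c * \<gamma> / \<mu> \<le> 8192 * c / (\<mu>\<^sup>2 * real K)"
    proof -
      have "\<gamma> * \<mu> * real K \<le> 32"
        using True q by (simp add: q_def field_simps)
      then have "32 * c * (\<gamma> * \<mu> * real K) \<le> 32 * c * 256"
        using pos by (intro mult_left_mono) auto
      then show ?thesis
        using pos by (simp add: field_simps power2_eq_square)
    qed
    ultimately show ?thesis by (simp add: q_def)
  next
    case False
    \<comment> \<open>The bias is already small after the first half and is only required not to grow; the noise
      follows \<open>C / t\<close>.\<close>
    define B where "B = exp (- (q * real K / 64)) * r 0"
    define C where "C = 4096 * c * \<gamma> / \<mu>"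
    have BC: "0 \<le> B" "0 \<le> C" using r0 pos by (auto simp: B_def C_def)
    have decay: "r (k0 + j) \<le> B + C / (64 + q * real j)" for j
    proof (induction j)
      case 0
      have "iseg_beta \<gamma> \<mu> K j = 1" if "j < k0" for j
        using that by (simp add: iseg_beta_def k0_def Let_def)
      then have "r k0 \<le> exp (- (q * real k0 / 32)) * r 0 + 32 * c * \<gamma> / \<mu>"
        by (rule constant_stage)
      moreover have "exp (- (q * real k0 / 32)) * r 0 \<le> B"
      proof -
        have "q * real K \<le> q * (real k0 * 2)"
          using q k0 by (intro mult_left_mono) auto
        then show ?thesis
          unfolding B_def using r0 by (intro mult_right_mono) auto
      qed
      moreover have "32 * c * \<gamma> / \<mu> \<le> C / 64"
        using pos by (simp add: C_def field_simps)
      ultimately show ?case by simp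
    next
      case (Suc j)
      define t where "t = 64 + q * real j"
      have t: "64 \<le> t" using q by (simp add: t_def)
      have "\<not> k0 + j < k0" by simp
      then have beta: "iseg_beta \<gamma> \<mu> K (k0 + j) = 64 / t"
        using False by (simp add: iseg_beta_def k0_def[symmetric] t_def q_def Let_def)
      have "r (Suc (k0 + j)) \<le> (1 - 64 / t * q / 32) * r (k0 + j) + c * (64 / t * \<gamma>)\<^sup>2"
        using rec[of "k0 + j"] by (simp add: beta q_def mult.assoc)
      also have "c * (64 / t * \<gamma>)\<^sup>2 = C * q / t\<^sup>2"
        using pos by (simp add: C_def q_def field_simps power2_eq_square)
      also have "1 - 64 / t * q / 32 = 1 - 2 * q / t" by simp
      also have "(1 - 2 * q / t) * r (k0 + j) \<le> (1 - 2 * q / t) * (B + C / t)"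
        using Suc t q by (intro mult_left_mono) (auto simp: t_def[symmetric])
      also have "(1 - 2 * q / t) * (B + C / t) + C * q / t\<^sup>2
          = (1 - 2 * q / t) * B + C * ((t - q) / t\<^sup>2)"
        using t by (simp add: field_simps power2_eq_square)
      also have "(1 - 2 * q / t) * B \<le> 1 * B"
        using BC t q by (intro mult_right_mono) auto
      also have "C * ((t - q) / t\<^sup>2) \<le> C * (1 / (t + q))"
        using t q BC by (intro mult_left_mono) (simp_all add: field_simps power2_eq_square)
      finally show ?case
        by (simp add: t_def add_ac distrib_left)
    qed
    \<comment> \<open>Rounding up \<open>K / 2\<close> loses at most half a step, which the offset 64 covers.\<close>
    have "q * real K / 2 \<le> 64 + q * real (K - k0)"
    proof -
      have "q * ((real K - 1) / 2) \<le> q * real (K - k0)"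
        using q k0 by (intro mult_left_mono) (auto simp: of_nat_diff)
      then show ?thesis using q by (simp add: algebra_simps)
    qed
    then have "C / (64 + q * real (K - k0)) \<le> C / (q * real K / 2)"
      using BC q pos by (intro divide_left_mono mult_pos_pos add_pos_nonneg) auto
    also have "\<dots> = 8192 * c / (\<mu>\<^sup>2 * real K)"
      using pos by (simp add: C_def q_def field_simps power2_eq_square)
    finally show ?thesis
      using decay[of "K - k0"] k0 by (simp add: B_def q_def)
  qed
qed

section \<open>The initial stepsize and the condition number\<close>

text \<open>
  A unit vector exists in \<open>real^'n\<close>, and one step away from the solution the two growth
  conditions on \<open>F\<close> compare \<open>\<mu>\<close> with \<open>L\<close>.
\<close>

lemma lipschitz_const_ge_mu:
  fixes F :: "real^'n \<Rightarrow> real^'n"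
  assumes lip: "L-lipschitz_on UNIV F" and qsm: "quasi_strongly_monotone \<mu> F xs"
    and sol: "F xs = 0"
  shows "\<mu> \<le> L"
proof -
  define y :: "real^'n" where "y = xs + axis undefined 1"
  have n: "norm (y - xs) = 1" by (simp add: y_def norm_axis_1)
  have "\<mu> \<le> F y \<bullet> (y - xs)"
    using qsm[unfolded quasi_strongly_monotone_def, rule_format, of y] n by simp
  also have "\<dots> \<le> norm (F y) * norm (y - xs)" by (rule norm_cauchy_schwarz)
  also have "\<dots> \<le> L" using lipschitz_onD[OF lip, of y xs] n sol by (simp add: dist_norm)
  finally show ?thesis .
qed

lemma iseg_gamma_bounds:
  assumes mu: "0 < \<mu>" and L: "0 \<le> L" and d: "0 \<le> \<delta>" and b: "1 \<le> b"
  defines "\<gamma> \<equiv> iseg_gamma L \<mu> \<delta> b"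
  shows "0 < \<gamma>" "\<gamma> * \<mu> \<le> 1 / 4" "6 * L\<^sup>2 * \<gamma>\<^sup>2 \<le> 1" "\<gamma> * (\<delta> / real b) \<le> \<mu> / 18"
proof -
  define w where "w = sqrt (6 * (L\<^sup>2 + 2 * \<delta> / real b))"
  have w: "0 \<le> w" using L d by (simp add: w_def)
  have "0 < 1 / (4 * \<mu> + w)" using mu w by simp
  moreover have "0 < \<mu> * real b / (18 * \<delta>)" if "\<delta> \<noteq> 0" using that mu b d by simp
  ultimately show pos: "0 < \<gamma>"
    unfolding \<gamma>_def iseg_gamma_def w_def[symmetric] Let_def by auto
  have "\<gamma> \<le> 1 / (4 * \<mu> + w)"
    unfolding \<gamma>_def iseg_gamma_def w_def[symmetric] Let_def by simp
  then have le: "\<gamma> * (4 * \<mu> + w) \<le> 1"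
    using mu w by (simp add: field_simps)
  then show "\<gamma> * \<mu> \<le> 1 / 4"
    using mult_nonneg_nonneg[OF less_imp_le[OF pos] w] by (simp add: algebra_simps)
  have "\<gamma> * w \<le> 1"
    using le mult_pos_pos[OF pos mu] by (simp add: algebra_simps)
  then have "(\<gamma> * w)\<^sup>2 \<le> 1"
    using pos w by (intro power_le_one) auto
  moreover have "w\<^sup>2 = 6 * L\<^sup>2 + 12 * (\<delta> / real b)"
    using d by (simp add: w_def)
  moreover have "0 \<le> \<gamma>\<^sup>2 * (12 * (\<delta> / real b))" using d by simp
  ultimately show "6 * L\<^sup>2 * \<gamma>\<^sup>2 \<le> 1"
    by (simp add: power_mult_distrib algebra_simps)
  show "\<gamma> * (\<delta> / real b) \<le> \<mu> / 18"
  proof (cases "\<delta> = 0")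
    case False
    then have "\<gamma> \<le> \<mu> * real b / (18 * \<delta>)"
      by (simp add: \<gamma>_def iseg_gamma_def Let_def)
    then show ?thesis using False d b by (simp add: field_simps)
  qed (use mu in simp)
qed

text \<open>
  The first term of the minimum gives \<open>1 / (18 * \<kappa>)\<close> directly. For the second one the square
  root is at most \<open>4 * (L + sqrt (\<delta> / b)) \<le> 4 * \<kappa> * \<mu>\<close>, hence even \<open>1 / (8 * \<kappa>)\<close> is a lower bound.
\<close>

lemma iseg_gamma_ge_inverse_kappa:
  assumes mu: "0 < \<mu>" "\<mu> \<le> L" and d: "0 \<le> \<delta>" and b: "1 \<le> b"
  defines "\<gamma> \<equiv> iseg_gamma L \<mu> \<delta> b" and "\<kappa> \<equiv> iseg_kappa L \<mu> \<delta> b"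
  shows "1 \<le> \<kappa>" "1 / (18 * \<kappa>) \<le> \<gamma> * \<mu>"
proof -
  define w where "w = sqrt (6 * (L\<^sup>2 + 2 * \<delta> / real b))"
  define v where "v = sqrt (\<delta> / real b)"
  have v: "0 \<le> v" "v\<^sup>2 = \<delta> / real b" using d by (auto simp: v_def)
  have k: "L + v \<le> \<kappa> * \<mu>" "\<delta> / (\<mu>\<^sup>2 * real b) \<le> \<kappa>"
    using mu by (auto simp: \<kappa>_def iseg_kappa_def v_def[symmetric] max_def field_simps split: if_splits)
  have mu_le: "\<mu> \<le> \<kappa> * \<mu>" using k(1) v(1) mu by linarith
  then show k1: "1 \<le> \<kappa>" using mu by simp
  have w: "0 \<le> w" using d by (simp add: w_def)
  have "w \<le> 4 * (L + v)"
  proof -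
    have "6 * (L\<^sup>2 + 2 * \<delta> / real b) \<le> (4 * (L + v))\<^sup>2"
    proof -
      have "0 \<le> v\<^sup>2" "0 \<le> L * v" "0 \<le> L\<^sup>2"
        using v(1) mu by simp_all
      moreover have "6 * (L\<^sup>2 + 2 * \<delta> / real b) = 6 * L\<^sup>2 + 12 * v\<^sup>2"
        by (simp add: v)
      moreover have "(4 * (L + v))\<^sup>2 = 16 * L\<^sup>2 + 32 * (L * v) + 16 * v\<^sup>2"
        by (simp add: power2_sum power_mult_distrib)
      ultimately show ?thesis by linarith
    qed
    then show ?thesis
      unfolding w_def using v mu by (intro real_le_lsqrt) auto
  qed
  also have "4 * (L + v) \<le> 4 * (\<kappa> * \<mu>)"
    using k(1) by simp
  finally have "4 * \<mu> + w \<le> 8 * \<kappa> * \<mu>"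
    using mu_le by simp
  also have "\<dots> \<le> 18 * \<kappa> * \<mu>" using k1 mu by simp
  finally have t: "1 / (18 * \<kappa>) \<le> 1 / (4 * \<mu> + w) * \<mu>"
    using mu w k1 by (simp add: field_simps)
  show "1 / (18 * \<kappa>) \<le> \<gamma> * \<mu>"
  proof (cases "\<delta> = 0")
    case True
    then show ?thesis using t by (simp add: \<gamma>_def iseg_gamma_def w_def)
  next
    case False
    have "\<delta> \<le> \<kappa> * (\<mu>\<^sup>2 * real b)" using k(2) mu b by (simp add: field_simps)
    then have "1 / (18 * \<kappa>) \<le> \<mu> * real b / (18 * \<delta>) * \<mu>"
      using False d k1 by (simp add: field_simps power2_eq_square)
    then show ?thesis
      unfolding \<gamma>_def iseg_gamma_def Let_def w_def[symmetric] using t False by (simp add: min_def)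
  qed
qed

section \<open>Second moments of minibatches\<close>

lemma nn_integral_norm_add_centered:
  fixes Z :: "'s \<Rightarrow> 'v::euclidean_space"
  assumes D: "prob_space D" and Z: "integrable D Z" "(\<integral>s. Z s \<partial>D) = 0"
    and Z2: "integrable D (\<lambda>s. (norm (Z s))\<^sup>2)"
  shows "(\<integral>\<^sup>+ s. ennreal ((norm (u + c *\<^sub>R Z s))\<^sup>2) \<partial>D)
     = ennreal ((norm u)\<^sup>2 + c\<^sup>2 * (\<integral>s. (norm (Z s))\<^sup>2 \<partial>D))"
proof -
  interpret D: prob_space D by fact
  have eq: "(norm (u + c *\<^sub>R Z s))\<^sup>2 = (norm u)\<^sup>2 + 2 * c * (u \<bullet> Z s) + c\<^sup>2 * (norm (Z s))\<^sup>2" for s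
    unfolding power2_norm_eq_inner
    by (simp add: inner_add_left inner_add_right inner_commute power2_eq_square algebra_simps)
  have uZ: "integrable D (\<lambda>s. u \<bullet> Z s)" using Z by simp
  have "(\<integral>s. u \<bullet> Z s \<partial>D) = 0" using Z by simp
  then have "(\<integral>s. (norm (u + c *\<^sub>R Z s))\<^sup>2 \<partial>D) = (norm u)\<^sup>2 + c\<^sup>2 * (\<integral>s. (norm (Z s))\<^sup>2 \<partial>D)"
    unfolding eq using Z2 uZ by (simp add: D.prob_space)
  moreover have "integrable D (\<lambda>s. (norm (u + c *\<^sub>R Z s))\<^sup>2)"
    unfolding eq using Z2 uZ by simp
  ultimately show ?thesis
    by (subst nn_integral_eq_integral) auto
qed

text \<open>
  Integrating out one coordinate at a time, with the partial sum as the new offset \<open>u\<close>, avoids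
  the covariances of distinct coordinates: each step adds exactly one variance.
\<close>

lemma nn_integral_norm_add_sum_centered:
  fixes Z :: "'s \<Rightarrow> 'v::euclidean_space"
  assumes D: "prob_space D" and Z: "integrable D Z" "(\<integral>s. Z s \<partial>D) = 0"
    and Z2: "integrable D (\<lambda>s. (norm (Z s))\<^sup>2)" and I: "finite I"
  shows "(\<integral>\<^sup>+ p. ennreal ((norm (u + c *\<^sub>R (\<Sum>i\<in>I. Z (p i))))\<^sup>2) \<partial>(\<Pi>\<^sub>M i\<in>I. D))
     = ennreal ((norm u)\<^sup>2 + c\<^sup>2 * (real (card I) * (\<integral>s. (norm (Z s))\<^sup>2 \<partial>D)))"
  using I
proof (induction I arbitrary: u)
  case empty
  show ?case by (simp add: PiM_empty nn_integral_count_space_finite)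
next
  case (insert i I)
  interpret D: prob_space D by fact
  interpret product_sigma_finite "\<lambda>_. D" ..
  have [measurable]: "Z \<in> borel_measurable D" using Z by auto
  let ?v = "\<integral>s. (norm (Z s))\<^sup>2 \<partial>D"
  have "(\<integral>\<^sup>+ p. ennreal ((norm (u + c *\<^sub>R (\<Sum>i\<in>insert i I. Z (p i))))\<^sup>2) \<partial>(\<Pi>\<^sub>M i\<in>insert i I. D))
     = (\<integral>\<^sup>+ p. (\<integral>\<^sup>+ s. ennreal ((norm ((u + c *\<^sub>R (\<Sum>j\<in>I. Z (p j))) + c *\<^sub>R Z s))\<^sup>2) \<partial>D) \<partial>(\<Pi>\<^sub>M i\<in>I. D))"
  proof (subst product_nn_integral_insert)
    have "(\<Sum>j\<in>I. Z (if j = i then s else p j)) = (\<Sum>j\<in>I. Z (p j))" for p s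
      using insert by (intro sum.cong) auto
    then show "(\<integral>\<^sup>+ p. (\<integral>\<^sup>+ s. ennreal ((norm (u + c *\<^sub>R (\<Sum>j\<in>insert i I. Z ((p(i := s)) j))))\<^sup>2) \<partial>D)
        \<partial>(\<Pi>\<^sub>M i\<in>I. D))
      = (\<integral>\<^sup>+ p. (\<integral>\<^sup>+ s. ennreal ((norm ((u + c *\<^sub>R (\<Sum>j\<in>I. Z (p j))) + c *\<^sub>R Z s))\<^sup>2) \<partial>D) \<partial>(\<Pi>\<^sub>M i\<in>I. D))"
      using insert by (simp add: algebra_simps fun_upd_def)
  qed (use insert in auto)
  also have "\<dots> = (\<integral>\<^sup>+ p. ennreal ((norm (u + c *\<^sub>R (\<Sum>j\<in>I. Z (p j))))\<^sup>2) + ennreal (c\<^sup>2 * ?v)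
      \<partial>(\<Pi>\<^sub>M i\<in>I. D))"
    by (simp add: nn_integral_norm_add_centered[OF D Z Z2] ennreal_plus)
  also have "\<dots> = ennreal ((norm u)\<^sup>2 + c\<^sup>2 * (real (card I) * ?v)) + ennreal (c\<^sup>2 * ?v)"
  proof -
    interpret P: prob_space "\<Pi>\<^sub>M i\<in>I. D" by (intro prob_space_PiM D)
    show ?thesis
      by (subst nn_integral_add) (auto simp: insert.IH P.emeasure_space_1)
  qed
  also have "\<dots> = ennreal ((norm u)\<^sup>2 + c\<^sup>2 * (real (card (insert i I)) * ?v))"
    using insert by (subst ennreal_plus[symmetric]) (auto simp: algebra_simps)
  finally show ?case .
qed

text \<open>
  The minibatch is its mean plus a normalized sum of centered samples, so the cross term with the
  offset vanishes and the variance is divided by \<open>b\<close>. An arbitrary offset \<open>u\<close> serves both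
  half steps: for the update it is the current error, for the extrapolation it is \<open>- F x\<close>.
\<close>

lemma minibatch_second_moment:
  fixes Fs :: "'s \<Rightarrow> real^'n \<Rightarrow> real^'n"
  assumes D: "prob_space D" and unb: "unbiased_estimator D Fs F"
    and var: "bounded_variance D Fs F xs \<delta> \<sigma>" and b: "1 \<le> b"
  shows "(\<integral>\<^sup>+ s. ennreal ((norm (u + c *\<^sub>R minibatch Fs b s y))\<^sup>2) \<partial>(\<Pi>\<^sub>M i\<in>{1..b}. D))
     \<le> ennreal ((norm (u + c *\<^sub>R F y))\<^sup>2 + c\<^sup>2 * (\<delta> / real b * (norm (y - xs))\<^sup>2 + \<sigma>\<^sup>2 / real b))"
proof -
  interpret D: prob_space D by fact
  define v where "v = (\<integral>s. (norm (Fs s y - F y))\<^sup>2 \<partial>D)"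
  have Z: "integrable D (\<lambda>s. Fs s y - F y)" "(\<integral>s. Fs s y - F y \<partial>D) = 0"
    using unb by (auto simp: unbiased_estimator_def D.prob_space)
  have Z2: "integrable D (\<lambda>s. (norm (Fs s y - F y))\<^sup>2)" and v: "v \<le> \<delta> * (norm (y - xs))\<^sup>2 + \<sigma>\<^sup>2"
    using var by (auto simp: bounded_variance_def v_def)
  have split: "u + c *\<^sub>R minibatch Fs b s y
      = (u + c *\<^sub>R F y) + (c / real b) *\<^sub>R (\<Sum>i\<in>{1..b}. Fs (s i) y - F y)" for s
    using b by (simp add: minibatch_def sum_subtractf scaleR_diff_right sum_constant_scaleR del: sum_constant)
  have "(\<integral>\<^sup>+ s. ennreal ((norm (u + c *\<^sub>R minibatch Fs b s y))\<^sup>2) \<partial>(\<Pi>\<^sub>M i\<in>{1..b}. D))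
      = ennreal ((norm (u + c *\<^sub>R F y))\<^sup>2 + (c / real b)\<^sup>2 * (real b * v))"
    unfolding split v_def by (subst nn_integral_norm_add_sum_centered[OF D Z Z2]) auto
  also have "(c / real b)\<^sup>2 * (real b * v) = c\<^sup>2 * (v / real b)"
    using b by (simp add: power_divide power2_eq_square)
  also have "v / real b \<le> (\<delta> * (norm (y - xs))\<^sup>2 + \<sigma>\<^sup>2) / real b"
    using v by (intro divide_right_mono) auto
  also have "\<dots> = \<delta> / real b * (norm (y - xs))\<^sup>2 + \<sigma>\<^sup>2 / real b"
    by (simp add: add_divide_distrib)
  finally show ?thesis by (simp add: mult_left_mono ennreal_leI)
qed

section \<open>Averaging over independent fresh samples\<close>

text \<open>
  Independence of \<open>X\<close> and \<open>Y\<close> lets \<open>X\<close> be frozen while \<open>Y\<close> is averaged over a second copy of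
  the sample space.
\<close>

lemma (in prob_space) nn_integral_indep_var_freeze:
  assumes ind: "indep_var S X T Y" and f[measurable]: "f \<in> borel_measurable (S \<Otimes>\<^sub>M T)"
  shows "(\<integral>\<^sup>+ \<omega>. f (X \<omega>, Y \<omega>) \<partial>M) = (\<integral>\<^sup>+ \<omega>. (\<integral>\<^sup>+ \<omega>'. f (X \<omega>, Y \<omega>') \<partial>M) \<partial>M)"
proof -
  have X[measurable]: "X \<in> M \<rightarrow>\<^sub>M S" and [measurable]: "Y \<in> M \<rightarrow>\<^sub>M T"
    using ind by (auto dest: indep_var_rv1 indep_var_rv2)
  interpret Y: prob_space "distr M T Y" by (rule prob_space_distr) measurable
  have "(\<integral>\<^sup>+ \<omega>. f (X \<omega>, Y \<omega>) \<partial>M) = integral\<^sup>N (distr M (S \<Otimes>\<^sub>M T) (\<lambda>\<omega>. (X \<omega>, Y \<omega>))) f"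
    by (simp add: nn_integral_distr)
  also have "\<dots> = integral\<^sup>N (distr M S X \<Otimes>\<^sub>M distr M T Y) f"
    using ind by (simp add: indep_var_distribution_eq)
  also have "\<dots> = (\<integral>\<^sup>+ x. (\<integral>\<^sup>+ y. f (x, y) \<partial>distr M T Y) \<partial>distr M S X)"
    by (rule Y.nn_integral_fst[symmetric]) simp
  also have "\<dots> = (\<integral>\<^sup>+ \<omega>. (\<integral>\<^sup>+ y. f (X \<omega>, y) \<partial>distr M T Y) \<partial>M)"
    by (rule nn_integral_distr) simp_all
  also have "\<dots> = (\<integral>\<^sup>+ \<omega>. (\<integral>\<^sup>+ \<omega>'. f (X \<omega>, Y \<omega>') \<partial>M) \<partial>M)"
    using measurable_space[OF X]
    by (intro nn_integral_cong nn_integral_distr) simp_all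
  finally show ?thesis .
qed

text \<open>
  The samples of one half step, indexed by \<open>J\<close> through \<open>r\<close>, may be replaced by a draw from the
  product law as long as everything else depends on other samples only. The two joint variables of
  \<open>indep_var\<close> have the same value type, so independence is used on the original index type and the
  block is pulled back along \<open>r\<close> afterwards.
\<close>

lemma (in prob_space) nn_integral_resample_block:
  assumes ind: "indep_vars (\<lambda>_. D) X I"
    and A: "A \<subseteq> I" and J: "J \<noteq> {}" and r: "inj_on r J" "r ` J \<subseteq> I" "A \<inter> r ` J = {}"
    and law: "\<And>j. j \<in> J \<Longrightarrow> distr M D (X (r j)) = D"
    and f: "f \<in> borel_measurable ((\<Pi>\<^sub>M i\<in>A. D) \<Otimes>\<^sub>M (\<Pi>\<^sub>M j\<in>J. D))"
  shows "(\<integral>\<^sup>+ \<omega>. f (\<lambda>i\<in>A. X i \<omega>, \<lambda>j\<in>J. X (r j) \<omega>) \<partial>M)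
       = (\<integral>\<^sup>+ \<omega>. (\<integral>\<^sup>+ s. f (\<lambda>i\<in>A. X i \<omega>, s) \<partial>(\<Pi>\<^sub>M j\<in>J. D)) \<partial>M)"
proof -
  define past where "past = (\<lambda>\<omega>. \<lambda>i\<in>A. X i \<omega>)"
  define fresh where "fresh = (\<lambda>\<omega>. \<lambda>i\<in>r ` J. X i \<omega>)"
  define block where "block = (\<lambda>\<omega>. \<lambda>j\<in>J. X (r j) \<omega>)"
  define pull where "pull = (\<lambda>q. \<lambda>j\<in>J. q (r j) :: 'c)"
  have block: "block \<omega> = pull (fresh \<omega>)" for \<omega>
    by (auto simp: fun_eq_iff restrict_def pull_def fresh_def block_def)
  have rv: "random_variable D (X i)" if "i \<in> I" for i
    using ind that by (auto simp: indep_vars_def)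
  have block_meas[measurable]: "block \<in> M \<rightarrow>\<^sub>M (\<Pi>\<^sub>M j\<in>J. D)"
      and [measurable]: "fresh \<in> M \<rightarrow>\<^sub>M (\<Pi>\<^sub>M i\<in>r ` J. D)"
      and past[measurable]: "past \<in> M \<rightarrow>\<^sub>M (\<Pi>\<^sub>M i\<in>A. D)"
    unfolding block_def fresh_def past_def using rv A r by (auto intro!: measurable_restrict)
  have [measurable]: "pull \<in> (\<Pi>\<^sub>M i\<in>r ` J. D) \<rightarrow>\<^sub>M (\<Pi>\<^sub>M j\<in>J. D)"
    unfolding pull_def by (auto intro!: measurable_restrict measurable_component_singleton)
  note f[measurable]
  obtain j0 where "j0 \<in> J" using J by blast
  then have D: "prob_space D"
    using prob_space_distr[of "X (r j0)" D] law rv r(2) by auto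
  have "distr M (\<Pi>\<^sub>M i\<in>r ` J. D) fresh = (\<Pi>\<^sub>M i\<in>r ` J. distr M D (X i))"
    unfolding fresh_def using J r(2) rv indep_vars_subset[OF ind r(2)]
    by (subst indep_vars_iff_distr_eq_PiM'[symmetric]) auto
  also have "\<dots> = (\<Pi>\<^sub>M i\<in>r ` J. D)"
    using law by (intro PiM_cong) auto
  finally have law_fresh: "distr M (\<Pi>\<^sub>M i\<in>r ` J. D) fresh = (\<Pi>\<^sub>M i\<in>r ` J. D)" .
  have "distr M (\<Pi>\<^sub>M j\<in>J. D) block
      = distr (distr M (\<Pi>\<^sub>M i\<in>r ` J. D) fresh) (\<Pi>\<^sub>M j\<in>J. D) pull"
    by (simp add: distr_distr o_def flip: block)
  also have "\<dots> = (\<Pi>\<^sub>M j\<in>J. D)"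
    unfolding law_fresh pull_def using distr_PiM_reindex[of "r ` J" "\<lambda>_. D" r J] D r(1) by auto
  finally have law_block: "distr M (\<Pi>\<^sub>M j\<in>J. D) block = (\<Pi>\<^sub>M j\<in>J. D)" .
  have "indep_var (\<Pi>\<^sub>M i\<in>A. D) past (\<Pi>\<^sub>M i\<in>r ` J. D) fresh"
    unfolding past_def fresh_def using r A by (intro indep_var_restrict[OF ind]) auto
  then have "(\<integral>\<^sup>+ \<omega>. (\<lambda>(p, q). f (p, pull q)) (past \<omega>, fresh \<omega>) \<partial>M)
      = (\<integral>\<^sup>+ \<omega>. (\<integral>\<^sup>+ \<omega>'. (\<lambda>(p, q). f (p, pull q)) (past \<omega>, fresh \<omega>') \<partial>M) \<partial>M)"
    by (rule nn_integral_indep_var_freeze) measurable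
  also have "\<dots> = (\<integral>\<^sup>+ \<omega>. (\<integral>\<^sup>+ s. f (past \<omega>, s) \<partial>distr M (\<Pi>\<^sub>M j\<in>J. D) block) \<partial>M)"
  proof (rule nn_integral_cong)
    fix \<omega> assume "\<omega> \<in> space M"
    then have "past \<omega> \<in> space (\<Pi>\<^sub>M i\<in>A. D)"
      by (rule measurable_space[OF past])
    then have "(\<lambda>s. f (past \<omega>, s)) \<in> borel_measurable (\<Pi>\<^sub>M j\<in>J. D)"
      by measurable
    then show "(\<integral>\<^sup>+ \<omega>'. (\<lambda>(p, q). f (p, pull q)) (past \<omega>, fresh \<omega>') \<partial>M)
      = (\<integral>\<^sup>+ s. f (past \<omega>, s) \<partial>distr M (\<Pi>\<^sub>M j\<in>J. D) block)"
      by (simp add: nn_integral_distr[OF block_meas] block)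
  qed
  finally show ?thesis
    by (simp only: law_block prod.case block[symmetric]) (simp only: past_def block_def)
qed

section \<open>The iterates as functions of the past samples\<close>

lemma borel_measurable_minibatch:
  fixes Fs :: "'s \<Rightarrow> 'v::euclidean_space \<Rightarrow> 'v"
  assumes joint: "(\<lambda>(s, x). Fs s x) \<in> borel_measurable (D \<Otimes>\<^sub>M borel)"
    and S: "\<And>i. i \<in> {1..b} \<Longrightarrow> (\<lambda>\<omega>. S \<omega> i) \<in> N \<rightarrow>\<^sub>M D"
    and X: "X \<in> borel_measurable N"
  shows "(\<lambda>\<omega>. minibatch Fs b (S \<omega>) (X \<omega>)) \<in> borel_measurable N"
proof -
  have "(\<lambda>\<omega>. Fs (S \<omega> i) (X \<omega>)) \<in> borel_measurable N" if "i \<in> {1..b}" for i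
    using measurable_compose[OF measurable_Pair[OF S[OF that] X] joint] by simp
  then show ?thesis unfolding minibatch_def by (auto intro!: borel_measurable_sum)
qed

lemma borel_measurable_iseg:
  fixes Fs :: "'s \<Rightarrow> 'v::euclidean_space \<Rightarrow> 'v"
  assumes joint: "(\<lambda>(s, x). Fs s x) \<in> borel_measurable (D \<Otimes>\<^sub>M borel)"
    and "\<And>l i. l < k \<Longrightarrow> i \<in> {1..b} \<Longrightarrow> (\<lambda>\<omega>. S1 \<omega> l i) \<in> N \<rightarrow>\<^sub>M D"
    and "\<And>l i. l < k \<Longrightarrow> i \<in> {1..b} \<Longrightarrow> (\<lambda>\<omega>. S2 \<omega> l i) \<in> N \<rightarrow>\<^sub>M D"
  shows "(\<lambda>\<omega>. iseg Fs b \<gamma>1 \<gamma>2 x0 (S1 \<omega>) (S2 \<omega>) k) \<in> borel_measurable N"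
  using assms(2,3)
proof (induction k)
  case (Suc k)
  let ?x = "\<lambda>\<omega>. iseg Fs b \<gamma>1 \<gamma>2 x0 (S1 \<omega>) (S2 \<omega>) k"
  have x[measurable]: "?x \<in> borel_measurable N"
    using Suc by simp
  have [measurable]: "(\<lambda>\<omega>. minibatch Fs b (S1 \<omega> k) (?x \<omega>)) \<in> borel_measurable N"
    by (rule borel_measurable_minibatch[OF joint Suc.prems(1) x]) auto
  have "(\<lambda>\<omega>. ?x \<omega> - \<gamma>1 k *\<^sub>R minibatch Fs b (S1 \<omega> k) (?x \<omega>)) \<in> borel_measurable N"
    by measurable
  then have [measurable]: "(\<lambda>\<omega>. minibatch Fs b (S2 \<omega> k) (?x \<omega> - \<gamma>1 k *\<^sub>R minibatch Fs b (S1 \<omega> k) (?x \<omega>)))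
      \<in> borel_measurable N"
    by (rule borel_measurable_minibatch[OF joint Suc.prems(2), rotated 2]) auto
  show ?case
    unfolding iseg.simps Let_def by measurable
qed simp

text \<open>
  The next two facts make the iterate a function of the samples restricted to the indices
  that it has consumed, as the resampling step requires.
\<close>

lemma minibatch_cong:
  assumes "\<And>i. i \<in> {1..b} \<Longrightarrow> s i = t i"
  shows "minibatch Fs b s x = minibatch Fs b t x"
proof -
  have "(\<Sum>i=1..b. Fs (s i) x) = (\<Sum>i=1..b. Fs (t i) x)"
    by (intro sum.cong) (simp_all add: assms)
  then show ?thesis by (simp only: minibatch_def)
qed

lemma iseg_cong:
  assumes "\<And>l i. l < k \<Longrightarrow> i \<in> {1..b} \<Longrightarrow> S1 l i = T1 l i"
    and "\<And>l i. l < k \<Longrightarrow> i \<in> {1..b} \<Longrightarrow> S2 l i = T2 l i"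
  shows "iseg Fs b \<gamma>1 \<gamma>2 x0 S1 S2 k = iseg Fs b \<gamma>1 \<gamma>2 x0 T1 T2 k"
  using assms
proof (induction k)
  case (Suc k)
  have "iseg Fs b \<gamma>1 \<gamma>2 x0 S1 S2 k = iseg Fs b \<gamma>1 \<gamma>2 x0 T1 T2 k"
    using Suc by simp
  moreover have "minibatch Fs b (S1 k) y = minibatch Fs b (T1 k) y"
    "minibatch Fs b (S2 k) y = minibatch Fs b (T2 k) y" for y
    using Suc.prems by (auto intro!: minibatch_cong)
  ultimately show ?case by (simp add: Let_def)
qed simp

section \<open>One iteration in mean square\<close>

text \<open>
  The fresh samples are averaged in the reverse order of their use: first the update samples, given
  the iterate and the extrapolation samples, then the extrapolation samples, given the iterate.
  Working with nonnegative integrals defers integrability to the conclusion, where it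
  follows from finiteness of the bound.
\<close>

lemma (in prob_space) iseg_mean_square_step:
  fixes F :: "real^'n \<Rightarrow> real^'n" and \<xi> :: "nat \<Rightarrow> nat \<Rightarrow> nat \<Rightarrow> 'a \<Rightarrow> 's"
    and k :: nat and x0 :: "real^'n" and \<gamma>1 \<gamma>2 :: "nat \<Rightarrow> real"
  assumes lip: "L-lipschitz_on UNIV F" and qsm: "quasi_strongly_monotone \<mu> F xs"
    and mu: "0 \<le> \<mu>" and nonneg: "0 \<le> \<delta>" and b: "1 \<le> b" and D: "prob_space D"
    and unb: "unbiased_estimator D Fs F" and var: "bounded_variance D Fs F xs \<delta> \<sigma>"
    and indep: "indep_vars (\<lambda>_. D) (\<lambda>(j, k, i). \<xi> j k i) ({1, 2} \<times> UNIV \<times> {1..b})"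
    and ident: "\<And>j k i. j \<in> {1, 2} \<Longrightarrow> i \<in> {1..b} \<Longrightarrow> distr M D (\<xi> j k i) = D"
    and a: "0 \<le> a" "a * \<mu> \<le> 1 / 4" "6 * L\<^sup>2 * a\<^sup>2 \<le> 1" "a * (\<delta> / real b) \<le> \<mu> / 18"
    and steps: "\<gamma>1 k = a" "\<gamma>2 k = a / 4"
  defines "x \<equiv> \<lambda>k \<omega>. iseg Fs b \<gamma>1 \<gamma>2 x0 (\<lambda>k i. \<xi> 1 k i \<omega>) (\<lambda>k i. \<xi> 2 k i \<omega>) k"
  shows "(\<integral>\<^sup>+ \<omega>. ennreal ((norm (x (Suc k) \<omega> - xs))\<^sup>2) \<partial>M)
     \<le> (\<integral>\<^sup>+ \<omega>. ennreal ((1 - a * \<mu> / 8) * (norm (x k \<omega> - xs))\<^sup>2 + 9 / 16 * a\<^sup>2 * (\<sigma>\<^sup>2 / real b)) \<partial>M)"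
proof -
  define d s where "d = \<delta> / real b" and "s = \<sigma>\<^sup>2 / real b"
  define P where "P = (\<Pi>\<^sub>M i\<in>{1..b}. D)"
  define X where "X = (\<lambda>(j, k, i). \<xi> j k i)"
  \<comment> \<open>\<open>A\<close> indexes the samples behind the current iterate \<open>G\<close>, \<open>A'\<close> those behind the
    extrapolation point \<open>Y\<close>.\<close>
  define A where "A = {1, 2::nat} \<times> {..<k} \<times> {1..b}"
  define A' where "A' = A \<union> {1} \<times> {k} \<times> {1..b}"
  define G :: "(nat \<times> nat \<times> nat \<Rightarrow> 's) \<Rightarrow> real^'n" where
    "G = (\<lambda>p. iseg Fs b \<gamma>1 \<gamma>2 x0 (\<lambda>l i. p (1, l, i)) (\<lambda>l i. p (2, l, i)) k)"
  define Y where "Y = (\<lambda>p. G p - a *\<^sub>R minibatch Fs b (\<lambda>i. p (1, k, i)) (G p))"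
  define q where "q = 1 - a * \<mu> / 6"
  have pos: "0 \<le> q" "0 \<le> d" "0 \<le> s"
    using a nonneg by (auto simp: q_def d_def s_def)
  have ds: "a * d \<le> \<mu> / 18" using a by (simp add: d_def)
  have joint: "(\<lambda>(s, x). Fs s x) \<in> borel_measurable (D \<Otimes>\<^sub>M borel)"
    using unb by (simp add: unbiased_estimator_def)
  have [measurable]: "F \<in> borel_measurable borel"
    using lipschitz_on_continuous_on[OF lip] by (rule borel_measurable_continuous_onI)
  have ind: "indep_vars (\<lambda>_. D) X ({1, 2} \<times> UNIV \<times> {1..b})"
    using indep by (simp add: X_def)
  have A_A': "A \<subseteq> A'" by (simp add: A'_def)
  have G_A[measurable]: "G \<in> borel_measurable (\<Pi>\<^sub>M i\<in>A. D)"
    unfolding G_def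
    by (intro borel_measurable_iseg[OF joint] measurable_component_singleton) (simp_all add: A_def)
  have G_A'[measurable]: "G \<in> borel_measurable (\<Pi>\<^sub>M i\<in>A'. D)"
    unfolding G_def
    by (intro borel_measurable_iseg[OF joint] measurable_component_singleton) (simp_all add: A_def A'_def)
  have Y_A'[measurable]: "Y \<in> borel_measurable (\<Pi>\<^sub>M i\<in>A'. D)"
  proof -
    have [measurable]: "(\<lambda>p. minibatch Fs b (\<lambda>i. p (1, k, i)) (G p)) \<in> borel_measurable (\<Pi>\<^sub>M i\<in>A'. D)"
      by (intro borel_measurable_minibatch[OF joint] measurable_component_singleton G_A')
        (auto simp: A'_def)
    show ?thesis unfolding Y_def by measurable
  qed
  have mb: "(\<lambda>(p, t). minibatch Fs b t (H p)) \<in> borel_measurable (N \<Otimes>\<^sub>M P)"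
    if [measurable]: "H \<in> borel_measurable N" for N and H :: "(nat \<times> nat \<times> nat \<Rightarrow> 's) \<Rightarrow> real^'n"
  proof -
    have "(\<lambda>z. minibatch Fs b (snd z) (H (fst z))) \<in> borel_measurable (N \<Otimes>\<^sub>M P)"
      unfolding P_def
      by (intro borel_measurable_minibatch[OF joint]
          measurable_compose[OF measurable_snd measurable_component_singleton]) auto
    then show ?thesis by (simp add: case_prod_beta')
  qed
  have G_past: "G (\<lambda>i\<in>B. X i \<omega>) = x k \<omega>" if "A \<subseteq> B" for B \<omega>
  proof -
    have "(j, l, i) \<in> B" if "j \<in> {1, 2}" "l < k" "i \<in> {1..b}" for j l i
      using that \<open>A \<subseteq> B\<close> by (auto simp: A_def)
    then show ?thesis
      unfolding G_def x_def by (intro iseg_cong) (simp_all add: X_def)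
  qed
  have block: "minibatch Fs b (\<lambda>i\<in>{1..b}. X (j, k, i) \<omega>) y = minibatch Fs b (\<lambda>i. \<xi> j k i \<omega>) y"
    for j \<omega> y by (intro minibatch_cong) (auto simp: X_def)
  define g y where "g = (\<lambda>\<omega>. minibatch Fs b (\<lambda>i. \<xi> 1 k i \<omega>) (x k \<omega>))" and "y = (\<lambda>\<omega>. x k \<omega> - a *\<^sub>R g \<omega>)"
  have Y_past: "Y (\<lambda>i\<in>A'. X i \<omega>) = y \<omega>" for \<omega>
  proof -
    have "minibatch Fs b (\<lambda>i. (\<lambda>i\<in>A'. X i \<omega>) (1, k, i)) (x k \<omega>) = g \<omega>"
      unfolding g_def by (intro minibatch_cong) (auto simp: A'_def X_def)
    then show ?thesis
      by (simp only: Y_def y_def G_past[OF A_A'])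
  qed
  have x_Suc: "x (Suc k) \<omega> - xs
      = (x k \<omega> - xs) + (- (a / 4)) *\<^sub>R minibatch Fs b (\<lambda>i. \<xi> 2 k i \<omega>) (y \<omega>)" for \<omega>
    by (simp add: x_def y_def g_def Let_def steps)
  \<comment> \<open>\<open>f2\<close> is the squared error after the update, as a function of the past and the update block;
    \<open>f1\<close> is its bound after averaging, as a function of the past and the extrapolation block.\<close>
  define f2 where "f2 = (\<lambda>(p, t). ennreal ((norm ((G p - xs) + (- (a / 4)) *\<^sub>R minibatch Fs b t (Y p)))\<^sup>2))"
  define f1 where "f1 = (\<lambda>(p, t). ennreal (q * (norm (G p - xs))\<^sup>2 + a\<^sup>2 / 16 * s
      + a\<^sup>2 / 2 * (norm (- F (G p) + 1 *\<^sub>R minibatch Fs b t (G p)))\<^sup>2))"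
  have f2_meas: "f2 \<in> borel_measurable ((\<Pi>\<^sub>M i\<in>A'. D) \<Otimes>\<^sub>M (\<Pi>\<^sub>M i\<in>{1..b}. D))"
    unfolding f2_def P_def[symmetric] using mb[OF Y_A'] by measurable
  have f1_meas: "f1 \<in> borel_measurable ((\<Pi>\<^sub>M i\<in>A. D) \<Otimes>\<^sub>M (\<Pi>\<^sub>M i\<in>{1..b}. D))"
    unfolding f1_def P_def[symmetric] using mb[OF G_A] by measurable
  have "(\<integral>\<^sup>+ \<omega>. ennreal ((norm (x (Suc k) \<omega> - xs))\<^sup>2) \<partial>M)
      = (\<integral>\<^sup>+ \<omega>. f2 (\<lambda>i\<in>A'. X i \<omega>, \<lambda>i\<in>{1..b}. X (2, k, i) \<omega>) \<partial>M)"
    by (simp only: f2_def prod.case G_past[OF A_A'] Y_past block x_Suc)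
  also have "\<dots> = (\<integral>\<^sup>+ \<omega>. (\<integral>\<^sup>+ t. f2 (\<lambda>i\<in>A'. X i \<omega>, t) \<partial>(\<Pi>\<^sub>M i\<in>{1..b}. D)) \<partial>M)"
    using b ident f2_meas
    by (intro nn_integral_resample_block[OF ind]) (auto simp: A_def A'_def X_def inj_on_def)
  also have "\<dots> \<le> (\<integral>\<^sup>+ \<omega>. f1 (\<lambda>i\<in>A. X i \<omega>, \<lambda>i\<in>{1..b}. X (1, k, i) \<omega>) \<partial>M)"
  proof (rule nn_integral_mono)
    fix \<omega>
    have "(\<integral>\<^sup>+ t. f2 (\<lambda>i\<in>A'. X i \<omega>, t) \<partial>(\<Pi>\<^sub>M i\<in>{1..b}. D))
        \<le> ennreal ((norm ((x k \<omega> - xs) + (- (a / 4)) *\<^sub>R F (y \<omega>)))\<^sup>2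
            + (- (a / 4))\<^sup>2 * (\<delta> / real b * (norm (y \<omega> - xs))\<^sup>2 + \<sigma>\<^sup>2 / real b))"
      using minibatch_second_moment[OF D unb var b, of "x k \<omega> - xs" "- (a / 4)" "y \<omega>"]
      by (simp only: f2_def prod.case Y_past G_past[OF A_A'])
    also have "\<dots> \<le> ennreal (q * (norm (x k \<omega> - xs))\<^sup>2 + a\<^sup>2 / 16 * s + a\<^sup>2 / 2 * (norm (g \<omega> - F (x k \<omega>)))\<^sup>2)"
      using extragradient_step_pointwise[OF lip qsm mu a(1-3) ds, of "x k \<omega>" "g \<omega>" s]
      by (intro ennreal_leI) (simp add: y_def q_def d_def s_def)
    also have "\<dots> = f1 (\<lambda>i\<in>A. X i \<omega>, \<lambda>i\<in>{1..b}. X (1, k, i) \<omega>)"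
      by (simp only: f1_def prod.case G_past[OF order_refl] block g_def scaleR_one uminus_add_conv_diff)
    finally show "(\<integral>\<^sup>+ t. f2 (\<lambda>i\<in>A'. X i \<omega>, t) \<partial>(\<Pi>\<^sub>M i\<in>{1..b}. D))
        \<le> f1 (\<lambda>i\<in>A. X i \<omega>, \<lambda>i\<in>{1..b}. X (1, k, i) \<omega>)" .
  qed
  also have "\<dots> = (\<integral>\<^sup>+ \<omega>. (\<integral>\<^sup>+ t. f1 (\<lambda>i\<in>A. X i \<omega>, t) \<partial>(\<Pi>\<^sub>M i\<in>{1..b}. D)) \<partial>M)"
    using b ident f1_meas
    by (intro nn_integral_resample_block[OF ind]) (auto simp: A_def X_def inj_on_def)
  also have "\<dots> \<le> (\<integral>\<^sup>+ \<omega>. ennreal ((1 - a * \<mu> / 8) * (norm (x k \<omega> - xs))\<^sup>2 + 9 / 16 * a\<^sup>2 * s) \<partial>M)"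
  proof (rule nn_integral_mono)
    fix \<omega>
    define e where "e = (norm (x k \<omega> - xs))\<^sup>2"
    have e: "0 \<le> e" by (simp add: e_def)
    interpret P: prob_space P unfolding P_def by (intro prob_space_PiM D)
    have [measurable]: "(\<lambda>t. minibatch Fs b t (x k \<omega>)) \<in> borel_measurable P"
      unfolding P_def by (intro borel_measurable_minibatch[OF joint] measurable_component_singleton) auto
    have "(\<integral>\<^sup>+ t. f1 (\<lambda>i\<in>A. X i \<omega>, t) \<partial>(\<Pi>\<^sub>M i\<in>{1..b}. D))
        = (\<integral>\<^sup>+ t. ennreal (q * e + a\<^sup>2 / 16 * s)
            + ennreal (a\<^sup>2 / 2) * ennreal ((norm (- F (x k \<omega>) + 1 *\<^sub>R minibatch Fs b t (x k \<omega>)))\<^sup>2) \<partial>P)"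
      unfolding P_def[symmetric] f1_def e_def using pos
      by (intro nn_integral_cong) (simp add: G_past[OF order_refl] flip: ennreal_plus ennreal_mult)
    also have "\<dots> = ennreal (q * e + a\<^sup>2 / 16 * s)
        + ennreal (a\<^sup>2 / 2) * (\<integral>\<^sup>+ t. ennreal ((norm (- F (x k \<omega>) + 1 *\<^sub>R minibatch Fs b t (x k \<omega>)))\<^sup>2) \<partial>P)"
    proof -
      have affine: "(\<integral>\<^sup>+ t. u + w * H t \<partial>P) = u + w * (\<integral>\<^sup>+ t. H t \<partial>P)"
        if "H \<in> borel_measurable P" for u w :: ennreal and H
        using that by (simp add: nn_integral_add nn_integral_cmult P.emeasure_space_1)
      show ?thesis by (rule affine) measurable
    qed
    also have "\<dots> \<le> ennreal (q * e + a\<^sup>2 / 16 * s) + ennreal (a\<^sup>2 / 2) * ennreal (d * e + s)"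
      using minibatch_second_moment[OF D unb var b, of "- F (x k \<omega>)" 1 "x k \<omega>"]
      unfolding P_def d_def s_def e_def by (intro add_left_mono mult_left_mono) auto
    also have "\<dots> = ennreal (q * e + a\<^sup>2 / 16 * s + a\<^sup>2 / 2 * (d * e + s))"
      using pos e by (simp flip: ennreal_plus ennreal_mult)
    also have "\<dots> \<le> ennreal ((1 - a * \<mu> / 8) * e + 9 / 16 * a\<^sup>2 * s)"
    proof (rule ennreal_leI)
      have "a * ((a * d) * e) \<le> a * (\<mu> / 18 * e)"
        using a ds e by (intro mult_left_mono mult_right_mono) auto
      then have "a\<^sup>2 * d * e \<le> a * \<mu> * e / 18"
        by (simp add: power2_eq_square mult.assoc)
      moreover have "0 \<le> a * \<mu> * e" using a mu e by simp
      moreover have "a\<^sup>2 / 2 * (d * e + s) = a\<^sup>2 * d * e / 2 + a\<^sup>2 * s / 2"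
        by (simp add: distrib_left add_divide_distrib)
      moreover have "q * e = e - a * \<mu> * e / 6" "(1 - a * \<mu> / 8) * e = e - a * \<mu> * e / 8"
        by (simp_all add: q_def left_diff_distrib)
      ultimately show "q * e + a\<^sup>2 / 16 * s + a\<^sup>2 / 2 * (d * e + s)
          \<le> (1 - a * \<mu> / 8) * e + 9 / 16 * a\<^sup>2 * s"
        by linarith
    qed
    finally show "(\<integral>\<^sup>+ t. f1 (\<lambda>i\<in>A. X i \<omega>, t) \<partial>(\<Pi>\<^sub>M i\<in>{1..b}. D))
        \<le> ennreal ((1 - a * \<mu> / 8) * (norm (x k \<omega> - xs))\<^sup>2 + 9 / 16 * a\<^sup>2 * s)"
      by (simp add: e_def)
  qed
  finally show ?thesis by (simp add: s_def)
qed

section \<open>The convergence rate\<close>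

theorem corollaryF1:
  fixes F :: "real^'n \<Rightarrow> real^'n"
    and Fs :: "'s \<Rightarrow> real^'n \<Rightarrow> real^'n"
    and D :: "'s measure"
    and M :: "'w measure"
    and \<xi> :: "nat \<Rightarrow> nat \<Rightarrow> nat \<Rightarrow> 'w \<Rightarrow> 's"
    and xs x0 :: "real^'n"
    and L \<mu> \<delta> \<sigma> \<gamma> \<kappa> :: real
    and b K :: nat
    and \<beta> \<gamma>1 \<gamma>2 :: "nat \<Rightarrow> real"
    and x :: "nat \<Rightarrow> 'w \<Rightarrow> real^'n"
  assumes lipschitz: "L-lipschitz_on UNIV F"
    and mu: "\<mu> > 0"
    and qsm: "quasi_strongly_monotone \<mu> F xs"
    and sol: "F xs = 0" "\<And>y. F y = 0 \<Longrightarrow> y = xs"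
    and nonneg: "\<delta> \<ge> 0" "\<sigma> \<ge> 0"
    and batch: "b \<ge> 1"
    and law: "prob_space D"
    and unbiased: "unbiased_estimator D Fs F"
    and variance: "bounded_variance D Fs F xs \<delta> \<sigma>"
    and space: "prob_space M"
    and indep: "prob_space.indep_vars M (\<lambda>_. D) (\<lambda>(j, k, i). \<xi> j k i) ({1, 2} \<times> UNIV \<times> {1..b})"
    and ident: "\<And>j k i. j \<in> {1, 2} \<Longrightarrow> i \<in> {1..b} \<Longrightarrow> distr M D (\<xi> j k i) = D"
    and gamma: "\<gamma> = iseg_gamma L \<mu> \<delta> b"
    and beta: "\<beta> = iseg_beta \<gamma> \<mu> K"
    and steps: "\<gamma>1 = (\<lambda>k. \<beta> k * \<gamma>)" "\<gamma>2 = (\<lambda>k. \<gamma>1 k / 4)"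
    and iterates: "\<And>k \<omega>. x k \<omega> = iseg Fs b \<gamma>1 \<gamma>2 x0 (\<lambda>k i. \<xi> 1 k i \<omega>) (\<lambda>k i. \<xi> 2 k i \<omega>) k"
    and kappa: "\<kappa> = iseg_kappa L \<mu> \<delta> b"
  shows "integrable M (\<lambda>\<omega>. (norm (x K \<omega> - xs))\<^sup>2)
    \<and> (\<integral>\<omega>. (norm (x K \<omega> - xs))\<^sup>2 \<partial>M)
        \<le> 1024 * (norm (x0 - xs))\<^sup>2 / (\<gamma> * \<mu>) * exp (- (\<gamma> * \<mu> * real K / 64))
          + 69120 * \<sigma>\<^sup>2 / (\<mu>\<^sup>2 * real b * real K)
    \<and> (iseg_c1 > 0 \<and> iseg_c2 > 0 \<and> iseg_c3 > 0
       \<and> (\<integral>\<omega>. (norm (x K \<omega> - xs))\<^sup>2 \<partial>M)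
           \<le> iseg_c1 * \<kappa> * (norm (x0 - xs))\<^sup>2 * exp (- (iseg_c2 * real K / \<kappa>))
             + iseg_c3 * \<sigma>\<^sup>2 / (\<mu>\<^sup>2 * real b * real K))"
proof -
  interpret prob_space M by (rule space)
  have L: "\<mu> \<le> L" using lipschitz_const_ge_mu[OF lipschitz qsm sol(1)] .
  have g: "0 < \<gamma>" "\<gamma> * \<mu> \<le> 1 / 4" "6 * L\<^sup>2 * \<gamma>\<^sup>2 \<le> 1" "\<gamma> * (\<delta> / real b) \<le> \<mu> / 18"
    unfolding gamma using iseg_gamma_bounds[OF mu _ nonneg(1) batch] mu L by auto
  have gm: "0 < \<gamma> * \<mu>" using g mu by simp
  have beta_bounds: "0 \<le> \<beta> k" "\<beta> k \<le> 1" for k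
    unfolding beta using iseg_beta_bounds[OF gm] by auto
  define c where "c = 9 / 16 * (\<sigma>\<^sup>2 / real b)"
  have c: "0 \<le> c" by (simp add: c_def)
  have joint: "(\<lambda>(s, x). Fs s x) \<in> borel_measurable (D \<Otimes>\<^sub>M borel)"
    using unbiased by (simp add: unbiased_estimator_def)
  have rv: "random_variable D (\<xi> j k i)" if "j \<in> {1, 2}" "i \<in> {1..b}" for j k i
    using indep that by (auto simp: indep_vars_def)
  have [measurable]: "x k \<in> borel_measurable M" for k
    unfolding iterates[abs_def] using rv by (intro borel_measurable_iseg[OF joint]) auto
  define r where "r k = expectation (\<lambda>\<omega>. (norm (x k \<omega> - xs))\<^sup>2)" for k
  have r_nonneg: "0 \<le> r k" for k by (simp add: r_def)
  have r0: "r 0 = (norm (x0 - xs))\<^sup>2"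
    by (simp add: r_def iterates prob_space)
  have step: "integrable M (\<lambda>\<omega>. (norm (x (Suc k) \<omega> - xs))\<^sup>2)
      \<and> r (Suc k) \<le> (1 - \<beta> k * \<gamma> * \<mu> / 8) * r k + c * (\<beta> k * \<gamma>)\<^sup>2"
    if int: "integrable M (\<lambda>\<omega>. (norm (x k \<omega> - xs))\<^sup>2)" for k
  proof -
    define a where "a = \<beta> k * \<gamma>"
    have a_le: "0 \<le> a" "a \<le> \<gamma>"
      using beta_bounds[of k] g by (auto simp: a_def mult_left_le_one_le)
    have a: "a * \<mu> \<le> 1 / 4" "6 * L\<^sup>2 * a\<^sup>2 \<le> 1" "a * (\<delta> / real b) \<le> \<mu> / 18"
    proof -
      show "a * \<mu> \<le> 1 / 4" using mult_right_mono[OF a_le(2), of \<mu>] g mu by linarith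
      have "a\<^sup>2 \<le> \<gamma>\<^sup>2" using a_le by (intro power_mono)
      then have "6 * L\<^sup>2 * a\<^sup>2 \<le> 6 * L\<^sup>2 * \<gamma>\<^sup>2" by (intro mult_left_mono) auto
      then show "6 * L\<^sup>2 * a\<^sup>2 \<le> 1" using g by simp
      show "a * (\<delta> / real b) \<le> \<mu> / 18"
        using order_trans[OF mult_right_mono[OF a_le(2)] g(4)] nonneg by simp
    qed
    define h where "h \<omega> = (1 - a * \<mu> / 8) * (norm (x k \<omega> - xs))\<^sup>2 + 9 / 16 * a\<^sup>2 * (\<sigma>\<^sup>2 / real b)" for \<omega>
    have h: "integrable M h" "\<And>\<omega>. 0 \<le> h \<omega>"
      using int a mu a_le unfolding h_def by auto
    have "(\<integral>\<^sup>+ \<omega>. ennreal ((norm (x (Suc k) \<omega> - xs))\<^sup>2) \<partial>M) \<le> (\<integral>\<^sup>+ \<omega>. ennreal (h \<omega>) \<partial>M)"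
      unfolding h_def iterates
      by (rule iseg_mean_square_step[OF lipschitz qsm less_imp_le[OF mu] nonneg(1) batch law unbiased
            variance indep ident a_le(1) a]) (simp_all add: steps a_def)
    also have "\<dots> = ennreal (expectation h)"
      using h by (intro nn_integral_eq_integral) auto
    finally have bound: "(\<integral>\<^sup>+ \<omega>. ennreal ((norm (x (Suc k) \<omega> - xs))\<^sup>2) \<partial>M) \<le> ennreal (expectation h)" .
    then have int': "integrable M (\<lambda>\<omega>. (norm (x (Suc k) \<omega> - xs))\<^sup>2)"
      by (intro integrableI_nonneg) (auto intro: le_less_trans)
    then have "ennreal (r (Suc k)) \<le> ennreal (expectation h)"
      using bound by (simp add: nn_integral_eq_integral r_def)
    then have "r (Suc k) \<le> expectation h"
      using h by (simp add: ennreal_le_iff)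
    also have "expectation h = (1 - a * \<mu> / 8) * r k + c * a\<^sup>2"
      unfolding h_def r_def c_def using int by (simp add: prob_space)
    finally show ?thesis using int' by (simp add: a_def)
  qed
  have int: "integrable M (\<lambda>\<omega>. (norm (x k \<omega> - xs))\<^sup>2)" for k
    by (induction k) (use step in \<open>auto simp: iterates\<close>)
  \<comment> \<open>The contraction is weakened to the rate for which the schedule is tuned.\<close>
  have rec: "r (Suc k) \<le> (1 - iseg_beta \<gamma> \<mu> K k * \<gamma> * \<mu> / 32) * r k + c * (iseg_beta \<gamma> \<mu> K k * \<gamma>)\<^sup>2" for k
  proof -
    have "0 \<le> \<beta> k * \<gamma> * \<mu> * r k" using beta_bounds[of k] g mu r_nonneg[of k] by simp
    then have "(1 - \<beta> k * \<gamma> * \<mu> / 8) * r k \<le> (1 - \<beta> k * \<gamma> * \<mu> / 32) * r k"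
      by (simp add: algebra_simps)
    then show ?thesis using step[OF int, of k] by (simp add: beta)
  qed
  define n where "n = 69120 * \<sigma>\<^sup>2 / (\<mu>\<^sup>2 * real b * real K)"
  have bound: "r K \<le> 1024 * (norm (x0 - xs))\<^sup>2 / (\<gamma> * \<mu>) * exp (- (\<gamma> * \<mu> * real K / 64)) + n"
  proof -
    have one: "1 \<le> 1024 / (\<gamma> * \<mu>)" using g gm by (simp add: field_simps)
    have "r K \<le> exp (- (\<gamma> * \<mu> * real K / 64)) * r 0 + n"
    \<comment> \<open>For \<open>K = 0\<close> the noise term is a division by zero, hence 0, and the claim is \<open>r 0 \<le> r 0\<close>.\<close>
    proof (cases "K = 0")
      case False
      have "r K \<le> exp (- (\<gamma> * \<mu> * real K / 64)) * r 0 + 8192 * c / (\<mu>\<^sup>2 * real K)"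
        using False g mu c r_nonneg rec by (intro stepsize_schedule_recursion) auto
      also have "8192 * c / (\<mu>\<^sup>2 * real K) = 4608 * (\<sigma>\<^sup>2 / (\<mu>\<^sup>2 * real b * real K))"
        by (simp add: c_def)
      also have "\<dots> \<le> 69120 * (\<sigma>\<^sup>2 / (\<mu>\<^sup>2 * real b * real K))"
        by (intro mult_right_mono) auto
      also have "\<dots> = n" by (simp add: n_def)
      finally show ?thesis by simp
    qed (simp add: n_def)
    also have "exp (- (\<gamma> * \<mu> * real K / 64)) * r 0 \<le> 1024 / (\<gamma> * \<mu>) * (exp (- (\<gamma> * \<mu> * real K / 64)) * r 0)"
      using mult_right_mono[OF one, of "exp (- (\<gamma> * \<mu> * real K / 64)) * r 0"] r_nonneg by simp
    finally show ?thesis by (simp add: r0 mult_ac)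
  qed
  have k: "1 \<le> \<kappa>" "1 / (18 * \<kappa>) \<le> \<gamma> * \<mu>"
    unfolding kappa gamma using iseg_gamma_ge_inverse_kappa[OF mu L nonneg(1) batch] by auto
  have "1024 * (norm (x0 - xs))\<^sup>2 / (\<gamma> * \<mu>) * exp (- (\<gamma> * \<mu> * real K / 64))
      \<le> iseg_c1 * \<kappa> * (norm (x0 - xs))\<^sup>2 * exp (- (iseg_c2 * real K / \<kappa>))"
  proof (rule mult_mono)
    have "1 / (\<gamma> * \<mu>) \<le> 18 * \<kappa>" using k gm by (simp add: field_simps)
    then have "1024 * (norm (x0 - xs))\<^sup>2 * (1 / (\<gamma> * \<mu>)) \<le> 1024 * (norm (x0 - xs))\<^sup>2 * (18 * \<kappa>)"
      by (intro mult_left_mono) auto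
    then show "1024 * (norm (x0 - xs))\<^sup>2 / (\<gamma> * \<mu>) \<le> iseg_c1 * \<kappa> * (norm (x0 - xs))\<^sup>2"
      by (simp add: iseg_c1_def mult_ac)
    have "1 / (18 * \<kappa>) * (real K / 64) \<le> \<gamma> * \<mu> * (real K / 64)"
      using k by (intro mult_right_mono) auto
    then show "exp (- (\<gamma> * \<mu> * real K / 64)) \<le> exp (- (iseg_c2 * real K / \<kappa>))"
      by (simp add: iseg_c2_def)
  qed (use k in \<open>auto simp: iseg_c1_def\<close>)
  then show ?thesis
    using int bound by (simp add: r_def n_def iseg_c1_def iseg_c2_def iseg_c3_def)
qed

end
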